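(* Let $v_F,m,\theta>0$ be constants and let $n_s,J_s^k:\mathbb{R}^2\to\mathbb{R}$ ($s=0,1,2,3$, $k=1,2$) be given functions. Suppose that $w^{eq}=(w^{eq}_0,w^{eq}_1,w^{eq}_2,w^{eq}_3)$ is a minimizer of the functional $\widetilde{\mathcal S}$ (defined in the context) among all admissible $w=(w_0,w_1,w_2,w_3)$ satisfying the constraints $$\int_{\mathbb{R}^2} w_s(r,p)\,dp=n_s(r),\qquad \int_{\mathbb{R}^2}p^k\,w_s(r,p)\,dp=J_s^k(r),\qquad s=0,1,2,3,\ k=1,2.$$ Then there exist real-valued functions $q_s^0(r)$, $q_s^k(r)$ of $r\in\mathbb{R}^2$ ($s=0,1,2,3$, $k=1,2$) such that, setting $$q_0(r,p)=1+q_0^0(r)+q_0^1(r)p^1+q_0^2(r)p^2+\frac{|p|^2}{2m\theta},$$ $$q_s(r,p)=q_s^0(r)+q_s^1(r)p^1+q_s^2(r)p^2,\qquad s=1,2,3,$$ $$Q=\big(q_1^2+q_2^2+q_3^2\big)^{1/2},$$ one has, for (almost every) $(r,p)\in\mathbb{R}^2\times\mathbb{R}^2$, $$w_0^{eq}(r,p)=\cosh(Q(r,p))\,e^{-q_0(r,p)},\qquad w_s^{eq}(r,p)=q_s(r,p)\,\frac{\sinh(Q(r,p))}{Q(r,p)}\,e^{-q_0(r,p)},\quad s=1,2,3,$$ where $\sinh(Q)/Q$ is understood as $1$ when $Q=0$.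
   Context: Phase-space variables are $r=(r_1,r_2)\in\mathbb{R}^2$ and $p=(p^1,p^2)\in\mathbb{R}^2$. A Wigner matrix is a Hermitian $2\times2$ matrix-valued function of $(r,p)$, identified with its four real Pauli components $w=(w_0,w_1,w_2,w_3)$, where $w_s=\frac12\mathrm{tr}(\sigma_s w)$, $\sigma_0$ is the identity and $\sigma_1,\sigma_2,\sigma_3$ are the Pauli matrices. Write $\vec w=(w_1,w_2,w_3)$ and $p\cdot\vec w=p^1w_1+p^2w_2$ (the third component of $p$ is taken to be $0$). Admissible $w$: measurable $w$ with $|\vec w|<w_0$ (almost everywhere) on $\mathbb{R}^2\times\mathbb{R}^2$, for which the moments $\int w_s\,dp$, $\int p^k w_s\,dp$ and the functional below are defined by absolutely convergent integrals. The (semiclassical) entropy functional is $$\widetilde{\mathcal S}(w)=\int_{\mathbb{R}^2\times\mathbb{R}^2}\Big[w_0\Big(\log(w_0)+c\Big(\frac{|\vec w|}{w_0}\Big)+\frac{|p|^2}{2m\theta}\Big)+\frac{v_F}{\theta}\,p\cdot\vec w\Big]\,dr\,dp,$$ with $$c(\lambda)=\frac12\log(1-\lambda^2)+\frac{\lambda}{2}\log\Big(\frac{1+\lambda}{1-\lambda}\Big),\qquad 0\le\lambda<1.$$ *)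

theory Defs
  imports "HOL-Analysis.Analysis"
begin

text \<open>
  A Wigner function is given by its four real Pauli components as a function of the phase-space
  point \<open>(r, p)\<close>. The components are indexed by the numeral type \<open>4\<close>, whose elements are
  \<open>0, 1, 2, 3\<close> (with \<open>4 = 0\<close>); the two coordinates of \<open>r\<close> and \<open>p\<close> are indexed by \<open>1, 2\<close> in
  the numeral type \<open>2\<close>.
\<close>

type_synonym wigner = "(real^2) \<times> (real^2) \<Rightarrow> real^4"

definition pauli_vec :: "real^4 \<Rightarrow> real^3" where
  "pauli_vec x = vector [x $ 1, x $ 2, x $ 3]"

definition entropy_c :: "real \<Rightarrow> real" where
  "entropy_c l = 1 / 2 * ln (1 - l\<^sup>2) + l / 2 * ln ((1 + l) / (1 - l))"

definition entropy_integrand ::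
    "real \<Rightarrow> real \<Rightarrow> real \<Rightarrow> wigner \<Rightarrow> (real^2) \<times> (real^2) \<Rightarrow> real" where
  "entropy_integrand vF m \<theta> w = (\<lambda>(r, p).
     w (r, p) $ 0 * (ln (w (r, p) $ 0) + entropy_c (norm (pauli_vec (w (r, p))) / w (r, p) $ 0)
                     + (norm p)\<^sup>2 / (2 * m * \<theta>))
     + vF / \<theta> * (p $ 1 * w (r, p) $ 1 + p $ 2 * w (r, p) $ 2))"

definition entropy :: "real \<Rightarrow> real \<Rightarrow> real \<Rightarrow> wigner \<Rightarrow> real" where
  "entropy vF m \<theta> w = integral\<^sup>L lebesgue (entropy_integrand vF m \<theta> w)"

text \<open>
  The moments are functions of \<open>r\<close> that are only determined almost everywhere, so their absolute
  convergence and their prescribed values are required for almost every \<open>r\<close>.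
\<close>

definition admissible :: "real \<Rightarrow> real \<Rightarrow> real \<Rightarrow> wigner \<Rightarrow> bool" where
  "admissible vF m \<theta> w \<longleftrightarrow>
     w \<in> borel_measurable lebesgue \<and>
     (AE x in lebesgue. norm (pauli_vec (w x)) < w x $ 0) \<and>
     (AE r in lebesgue. \<forall>s. integrable lebesgue (\<lambda>p. w (r, p) $ s) \<and>
                            (\<forall>k. integrable lebesgue (\<lambda>p. p $ k * w (r, p) $ s))) \<and>
     integrable lebesgue (entropy_integrand vF m \<theta> w)"

definition has_moments ::
    "(4 \<Rightarrow> real^2 \<Rightarrow> real) \<Rightarrow> (4 \<Rightarrow> 2 \<Rightarrow> real^2 \<Rightarrow> real) \<Rightarrow> wigner \<Rightarrow> bool" where
  "has_moments n J w \<longleftrightarrow>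
     (AE r in lebesgue. \<forall>s. integral\<^sup>L lebesgue (\<lambda>p. w (r, p) $ s) = n s r \<and>
                            (\<forall>k. integral\<^sup>L lebesgue (\<lambda>p. p $ k * w (r, p) $ s) = J s k r))"

definition sinhc :: "real \<Rightarrow> real" where
  "sinhc x = (if x = 0 then 1 else sinh x / x)"

end

theory Submission
  imports Defs
begin

text \<open>
  Write \<open>|w|\<close> for the length of the vector part of \<open>w\<close>. On the cone \<open>|w| < w\<^sub>0\<close> the
  entropy density is half the sum of \<open>x ln x\<close> over the two eigenvalues \<open>w\<^sub>0 \<plusminus> |w|\<close>, plus a linear term in \<open>w\<close>. It lies above its tangent, with an error
  of at most \<open>3/2 |h|\<^sup>2 / (w\<^sub>0 - |w|)\<close> for an increment \<open>h\<close>. Perturbing one component of the minimizer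
  by \<open>t \<eta>\<close>, where \<open>\<eta>\<close> has vanishing moments in \<open>p\<close> and is dominated by \<open>w\<^sub>0 - |w|\<close>, therefore shows
  that the gradient of the density is orthogonal to \<open>\<eta>\<close>. Choosing for \<open>\<eta>\<close> a weighted residual of
  that gradient after projection onto the functions affine in \<open>p\<close> shows that the residual vanishes.
  The gradient is thus affine in \<open>p\<close>, and inverting it gives the \<open>cosh\<close>/\<open>sinh\<close> formulas.
\<close>

section \<open>Tangent bounds for the spectral entropy\<close>

text \<open>Both bounds are \<open>ln z \<le> z - 1\<close>, taken at \<open>z = x / y\<close> for
  the first and at \<open>z = y / x\<close> for the second. The quadratic error involves only the
  base point \<open>x\<close>, so the size of the perturbed point never enters.\<close>

lemma xlnx_tangent_bounds:
  fixes x y :: real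
  assumes "x > 0" "y > 0"
  shows "(y - x) * (ln x + 1) \<le> y * ln y - x * ln x"
    and "y * ln y - x * ln x \<le> (y - x) * (ln x + 1) + (y - x)\<^sup>2 / x"
proof -
  have "y * ln (x / y) \<le> y * (x / y - 1)"
    using assms by (intro mult_left_mono ln_le_minus_one) auto
  also have "\<dots> = x - y"
    using assms by (simp add: right_diff_distrib)
  finally have "y * (ln x - ln y) \<le> x - y"
    using assms by (simp add: ln_div)
  then show "(y - x) * (ln x + 1) \<le> y * ln y - x * ln x"
    by (simp add: algebra_simps)
  have "y * ln (y / x) \<le> y * (y / x - 1)"
    using assms by (intro mult_left_mono ln_le_minus_one) auto
  also have "\<dots> = (y - x) + (y - x)\<^sup>2 / x"
    using assms by (simp add: field_simps power2_eq_square)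
  finally have "y * (ln y - ln x) \<le> (y - x) + (y - x)\<^sup>2 / x"
    using assms by (simp add: ln_div)
  then show "y * ln y - x * ln x \<le> (y - x) * (ln x + 1) + (y - x)\<^sup>2 / x"
    by (simp add: algebra_simps)
qed

text \<open>The lower bound is Cauchy-Schwarz for \<open>v\<close> and \<open>v + k\<close>. The
  upper bound is the expansion of \<open>(norm (v + k) - norm v)\<^sup>2 \<ge> 0\<close>.\<close>

lemma norm_add_tangent_bounds:
  fixes v k :: "'a::real_inner"
  assumes "v \<noteq> 0"
  shows "(v \<bullet> k) / norm v \<le> norm (v + k) - norm v"
    and "norm (v + k) - norm v \<le> (v \<bullet> k) / norm v + (norm k)\<^sup>2 / (2 * norm v)"
proof -
  have pos: "norm v > 0" using assms by simp
  have sq: "(norm (v + k))\<^sup>2 = (norm v)\<^sup>2 + 2 * (v \<bullet> k) + (norm k)\<^sup>2"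
    by (simp add: power2_norm_eq_inner inner_add inner_commute)
  have "v \<bullet> (v + k) \<le> norm v * norm (v + k)" by (rule norm_cauchy_schwarz)
  then have "(norm v)\<^sup>2 + v \<bullet> k \<le> norm v * norm (v + k)"
    by (simp add: inner_add power2_norm_eq_inner)
  then show "(v \<bullet> k) / norm v \<le> norm (v + k) - norm v"
    using pos by (simp add: field_simps power2_eq_square)
  have "0 \<le> (norm (v + k) - norm v)\<^sup>2" by simp
  then have "2 * norm v * (norm (v + k) - norm v) \<le> 2 * (v \<bullet> k) + (norm k)\<^sup>2"
    using sq by (simp add: power2_eq_square algebra_simps)
  then have "norm (v + k) - norm v \<le> (2 * (v \<bullet> k) + (norm k)\<^sup>2) / (2 * norm v)"
    using pos by (simp add: pos_le_divide_eq mult.commute)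
  also have "\<dots> = (v \<bullet> k) / norm v + (norm k)\<^sup>2 / (2 * norm v)"
    using pos by (simp add: field_simps)
  finally show "norm (v + k) - norm v \<le> (v \<bullet> k) / norm v + (norm k)\<^sup>2 / (2 * norm v)" .
qed

text \<open>\<open>D\<close> is the remainder of \<open>S\<close> after its linearization. In terms
  of the eigenvalues \<open>a\<close> and \<open>b\<close> the increments are \<open>h + d\<close>
  and \<open>h - d\<close>, so the scalar bounds for \<open>x ln x\<close> apply to each; what
  remains is the remainder of the norm itself, multiplied by \<open>L \<ge> 0\<close>.\<close>

lemma spectral_entropy_bregman_bounds:
  fixes v k :: "'a::real_inner" and x h :: real
  defines "S \<equiv> \<lambda>x r. ((x + r) * ln (x + r) + (x - r) * ln (x - r)) / 2"
  assumes v: "norm v < x" and k: "norm (v + k) < x + h"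
  defines "D \<equiv> S (x + h) (norm (v + k)) - S x (norm v)
      - (h * (1 + ln ((x + norm v) * (x - norm v)) / 2)
         + ln ((x + norm v) / (x - norm v)) / (2 * norm v) * (v \<bullet> k))"
  shows "0 \<le> D" and "D \<le> 3 / 2 * (h\<^sup>2 + (norm k)\<^sup>2) / (x - norm v)"
proof -
  define a b where "a = x + norm v" and "b = x - norm v"
  define d where "d = norm (v + k) - norm v"
  define L where "L = ln (a / b) / 2"
  have b: "0 < b" and ba: "b \<le> a" using v by (auto simp: a_def b_def)
  have a: "0 < a" using b ba by linarith
  have a': "0 < a + (h + d)" and b': "0 < b + (h - d)"
    using k norm_ge_zero[of "v + k"] by (simp_all add: a_def b_def d_def del: norm_ge_zero)
  have L0: "0 \<le> L" using b ba by (simp add: L_def)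
  \<comment> \<open>The resulting \<open>L \<le> norm v / b\<close> cancels the factor
    \<open>1 / norm v\<close> in the second-order term of the norm, so the final bound does not blow
    up as \<open>v\<close> tends to 0.\<close>
  have "ln (a / b) \<le> a / b - 1" using a b by (intro ln_le_minus_one) simp
  then have L1: "L \<le> norm v / b"
    using b by (simp add: L_def a_def b_def field_simps)
  have d2: "d\<^sup>2 \<le> (norm k)\<^sup>2"
    unfolding d_def by (metis abs_le_square_iff abs_norm_cancel add_diff_cancel_left' norm_triangle_ineq3)
  \<comment> \<open>Since \<open>L \<ge> 0\<close>, the tangent bounds for the norm may be
    multiplied by \<open>L\<close>. For \<open>v = 0\<close> one has \<open>L = 0\<close>, and the
    linear term vanishes as well.\<close>
  have dL: "L / norm v * (v \<bullet> k) \<le> d * L \<and>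
      d * L \<le> L / norm v * (v \<bullet> k) + (norm k)\<^sup>2 / (2 * b)"
  proof (cases "v = 0")
    case True
    then show ?thesis using L1 L0 b by simp
  next
    case False
    then have nv: "norm v > 0" by simp
    have "(v \<bullet> k) / norm v * L \<le> d * L"
      using norm_add_tangent_bounds(1)[OF False] L0 by (intro mult_right_mono) (auto simp: d_def)
    moreover have "d * L \<le> ((v \<bullet> k) / norm v + (norm k)\<^sup>2 / (2 * norm v)) * L"
      using norm_add_tangent_bounds(2)[OF False] L0 by (intro mult_right_mono) (auto simp: d_def)
    moreover have "(norm k)\<^sup>2 / (2 * norm v) * L \<le> (norm k)\<^sup>2 / (2 * norm v) * (norm v / b)"
      using L1 by (intro mult_left_mono) auto
    moreover have "(norm k)\<^sup>2 / (2 * norm v) * (norm v / b) = (norm k)\<^sup>2 / (2 * b)"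
      using nv by simp
    ultimately show ?thesis by (simp add: algebra_simps)
  qed
  note ta = xlnx_tangent_bounds[OF a a'] and tb = xlnx_tangent_bounds[OF b b']
  have S': "S (x + h) (norm (v + k)) = ((a + (h + d)) * ln (a + (h + d)) + (b + (h - d)) * ln (b + (h - d))) / 2"
    by (simp add: S_def a_def b_def d_def algebra_simps)
  have S: "S x (norm v) = (a * ln a + b * ln b) / 2"
    by (simp add: S_def a_def b_def)
  have g: "h * (1 + ln (a * b) / 2) + d * L = ((h + d) * (ln a + 1) + (h - d) * (ln b + 1)) / 2"
    using a b by (simp add: L_def ln_mult ln_div field_simps)
  have D: "D = S (x + h) (norm (v + k)) - S x (norm v) - (h * (1 + ln (a * b) / 2) + L / norm v * (v \<bullet> k))"
    by (simp add: D_def L_def a_def b_def)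
  define fa fb where "fa = (a + (h + d)) * ln (a + (h + d)) - a * ln a"
    and "fb = (b + (h - d)) * ln (b + (h - d)) - b * ln b"
  have ta': "(h + d) * (ln a + 1) \<le> fa" "fa \<le> (h + d) * (ln a + 1) + (h + d)\<^sup>2 / a"
    and tb': "(h - d) * (ln b + 1) \<le> fb" "fb \<le> (h - d) * (ln b + 1) + (h - d)\<^sup>2 / b"
    using ta tb by (simp_all add: fa_def fb_def)
  have "S (x + h) (norm (v + k)) - S x (norm v) = (fa + fb) / 2"
    unfolding S S' fa_def fb_def by argo
  \<comment> \<open>The remainder is half the sum of two scalar remainders plus that of the norm;
    each of the three is nonnegative.\<close>
  then have D': "D = (fa + fb) / 2 - ((h + d) * (ln a + 1) + (h - d) * (ln b + 1)) / 2
      + (d * L - L / norm v * (v \<bullet> k))"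
    unfolding D using g by argo
  show "0 \<le> D" using ta'(1) tb'(1) dL unfolding D' by argo
  \<comment> \<open>Passing to the smaller eigenvalue \<open>b\<close> in both denominators makes
    the mixed terms \<open>h * d\<close> cancel. Then \<open>d2\<close>, the reverse triangle
    inequality, replaces \<open>d\<close> by \<open>norm k\<close>.\<close>
  have "(h + d)\<^sup>2 / a \<le> (h + d)\<^sup>2 / b" using a b ba by (intro divide_left_mono) auto
  then have "D \<le> ((h + d)\<^sup>2 / b + (h - d)\<^sup>2 / b) / 2 + (norm k)\<^sup>2 / (2 * b)"
    using ta'(2) tb'(2) dL unfolding D' by argo
  also have "\<dots> = (h\<^sup>2 + d\<^sup>2) / b + (norm k)\<^sup>2 / (2 * b)"
    using b by (simp add: field_simps power2_eq_square)
  also have "\<dots> \<le> (h\<^sup>2 + (norm k)\<^sup>2) / b + (h\<^sup>2 + (norm k)\<^sup>2) / (2 * b)"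
    using b d2 by (intro add_mono divide_right_mono) auto
  also have "\<dots> = 3 / 2 * (h\<^sup>2 + (norm k)\<^sup>2) / b" using b by (simp add: field_simps)
  finally show "D \<le> 3 / 2 * (h\<^sup>2 + (norm k)\<^sup>2) / (x - norm v)" by (simp add: b_def)
qed

section \<open>Test functions orthogonal to finitely many moments\<close>

text \<open>Sigma-finiteness of Lebesgue measure provides a positive integrable function; truncating
  it at 1 also makes it bounded. It serves as a weight that turns pointwise bounds into
  integrability.\<close>

lemma ex_positive_integrable:
  "\<exists>W::'a::euclidean_space \<Rightarrow> real. W \<in> borel_measurable borel \<and> integrable lborel W \<and> (\<forall>x. 0 < W x \<and> W x \<le> 1)"
proof -
  obtain h :: "'a \<Rightarrow> ennreal" where [measurable]: "h \<in> borel_measurable lborel"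
    and fin: "integral\<^sup>N lborel h \<noteq> \<infinity>" and h: "\<And>x. 0 < h x \<and> h x < \<infinity>"
    using sigma_finite_measure.Ex_finite_integrable_function[OF lborel.sigma_finite_measure_axioms]
    by auto
  define W where "W x = min 1 (enn2real (h x))" for x
  have "0 < W x \<and> W x \<le> 1" for x
    using h[of x] by (auto simp: W_def enn2real_positive_iff)
  moreover have W[measurable]: "W \<in> borel_measurable borel"
    unfolding W_def by measurable
  moreover have "integrable lborel W"
  proof (rule integrableI_bounded)
    have "ennreal (norm (W x)) \<le> h x" for x
    proof -
      have "ennreal (norm (W x)) \<le> ennreal (enn2real (h x))"
        by (intro ennreal_leI) (auto simp: W_def min_def)
      also have "\<dots> = h x" using h[of x] by simp
      finally show ?thesis .
    qed
    then have "(\<integral>\<^sup>+x. ennreal (norm (W x)) \<partial>lborel) \<le> integral\<^sup>N lborel h"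
      by (intro nn_integral_mono) auto
    then show "(\<integral>\<^sup>+x. ennreal (norm (W x)) \<partial>lborel) < \<infinity>"
      using fin by (simp add: less_top top_unique)
  qed simp
  ultimately show ?thesis by blast
qed

lemma borel_measurable_cart_iff:
  fixes f :: "'a \<Rightarrow> real^'n"
  shows "f \<in> borel_measurable M \<longleftrightarrow> (\<forall>i. (\<lambda>x. f x $ i) \<in> borel_measurable M)"
proof -
  have "(\<lambda>x. f x \<bullet> axis i 1) = (\<lambda>x. f x $ i)" for i
    by (simp add: inner_axis)
  then show ?thesis
    unfolding borel_measurable_euclidean_space[of f M] by (auto simp: Basis_vec_def)
qed

text \<open>
  The test function is a multiple of the residual of the weighted least-squares projection of
  \<open>G(x, \<cdot>)\<close> onto the span of the components of \<open>u\<close>. The multiple depends only on \<open>x\<close>, so all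
  fibrewise moments vanish, and the pairing with \<open>G\<close> is a weighted square norm of the residual.
  Cramer's rule makes the coefficients \<open>\<alpha>\<close> measurable in \<open>x\<close>.
\<close>

lemma ex_orthogonal_test_function:
  fixes G d :: "'a::euclidean_space \<times> 'b::euclidean_space \<Rightarrow> real" and u :: "'b \<Rightarrow> real^'n"
  assumes [measurable]: "G \<in> borel_measurable borel" "d \<in> borel_measurable borel"
      "u \<in> borel_measurable borel"
    and d: "\<And>z. 0 < d z"
    and indep: "\<And>c. (AE y in lborel. c \<bullet> u y = 0) \<Longrightarrow> c = 0"
  obtains \<alpha> :: "'a \<Rightarrow> real^'n" and \<eta> :: "'a \<times> 'b \<Rightarrow> real"
  where "\<eta> \<in> borel_measurable borel" "\<And>z. \<bar>\<eta> z\<bar> \<le> d z"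
    "integrable lborel (\<lambda>z. \<eta> z * G z)" "integrable lborel (\<lambda>z. (\<eta> z)\<^sup>2 / d z)"
    "\<And>x i. integrable lborel (\<lambda>y. \<eta> (x, y) * u y $ i)"
    "\<And>x i. (\<integral>y. \<eta> (x, y) * u y $ i \<partial>lborel) = 0"
    "(\<integral>z. \<eta> z * G z \<partial>lborel) = 0 \<Longrightarrow> AE z in lborel. G z = \<alpha> (fst z) \<bullet> u (snd z)"
proof -
  have [measurable]: "(fst :: 'a \<times> 'b \<Rightarrow> 'a) \<in> borel_measurable borel"
      "(snd :: 'a \<times> 'b \<Rightarrow> 'b) \<in> borel_measurable borel"
    by (intro borel_measurable_continuous_onI continuous_intros)+
  have [measurable]: "(\<lambda>y. u y $ i) \<in> borel_measurable borel" for i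
    using assms(3) by (simp add: borel_measurable_cart_iff)
  obtain Wa :: "'a \<Rightarrow> real" where Wa[measurable]: "Wa \<in> borel_measurable borel"
    and Wai: "integrable lborel Wa" and Wa1: "\<And>x. 0 < Wa x \<and> Wa x \<le> 1"
    using ex_positive_integrable by blast
  obtain Wb :: "'b \<Rightarrow> real" where Wb[measurable]: "Wb \<in> borel_measurable borel"
    and Wbi: "integrable lborel Wb" and Wb1: "\<And>x. 0 < Wb x \<and> Wb x \<le> 1"
    using ex_positive_integrable by blast
  have Ei: "integrable lborel (\<lambda>z. Wa (fst z) * Wb (snd z))"
  proof -
    have "integrable (lborel \<Otimes>\<^sub>M lborel) (\<lambda>z. Wa (fst z) * Wb (snd z))"
    proof (rule lborel_pair.Fubini_integrable)
      show "integrable lborel (\<lambda>x. \<integral>y. norm (Wa (fst (x, y)) * Wb (snd (x, y))) \<partial>lborel)"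
        using Wai Wbi Wa1 Wb1 by (simp add: abs_mult less_imp_le)
      show "AE x in lborel. integrable lborel (\<lambda>y. Wa (fst (x, y)) * Wb (snd (x, y)))"
        using Wbi by simp
    qed (use Wa Wb in measurable)
    then show ?thesis by (simp add: lborel_prod)
  qed
  \<comment> \<open>This weight is positive, at most 1, and integrable both on the product and on
    every fibre. All integrability claims below are dominations by \<open>E\<close>.\<close>
  define E where "E z = Wa (fst z) * Wb (snd z)" for z
  have E[measurable]: "E \<in> borel_measurable borel"
    unfolding E_def borel_prod[symmetric] by measurable
  have E0: "0 < E z" and E1: "E z \<le> 1" for z
    using Wa1 Wb1 by (auto simp: E_def mult_le_one less_imp_le)
  have dom: "integrable lborel f" if "f \<in> borel_measurable borel" "\<And>z. \<bar>f z\<bar> \<le> E z"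
    for f :: "'a \<times> 'b \<Rightarrow> real"
    using Ei that E0 by (intro Bochner_Integration.integrable_bound[of lborel E f])
      (auto simp: E_def[abs_def] less_imp_le)
  have dom': "integrable lborel f" if "f \<in> borel_measurable borel" "\<And>y. \<bar>f y\<bar> \<le> E (x, y)"
    for f :: "'b \<Rightarrow> real" and x
  proof (rule Bochner_Integration.integrable_bound)
    show "integrable lborel (\<lambda>y. Wa x * Wb y)" using Wbi by simp
    show "AE y in lborel. norm (f y) \<le> norm (Wa x * Wb y)"
    proof (rule AE_I2)
      fix y show "norm (f y) \<le> norm (Wa x * Wb y)"
        using that(2)[of y] by (simp add: E_def)
    qed
  qed (use that in simp)
  define g U where "g z = 1 + \<bar>G z\<bar>" and "U y = 1 + norm (u y)" for z y
  have g1: "1 \<le> g z" and U1: "1 \<le> U y" for z y by (auto simp: g_def U_def)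
  have [measurable]: "g \<in> borel_measurable borel" "U \<in> borel_measurable borel"
    unfolding g_def[abs_def] U_def[abs_def] by measurable
  have uU: "\<bar>u y $ i\<bar> \<le> U y" for y i
    using component_le_norm_cart[of "u y" i] by (simp add: U_def)
  \<comment> \<open>The denominator compensates the growth of \<open>u\<close> and \<open>G\<close>:
    multiplied by anything bounded by \<open>(c z)\<^sup>2\<close>, the weight stays below
    \<open>E\<close>. The factor \<open>min 1 (d z)\<close> is what later gives
    \<open>\<bar>\<eta> z\<bar> \<le> d z\<close>.\<close>
  define \<rho> where "\<rho> z = E z * min 1 (d z) / ((U (snd z))\<^sup>2 * (g z)\<^sup>2)" for z
  have [measurable]: "\<rho> \<in> borel_measurable borel"
    unfolding \<rho>_def by measurable
  have \<rho>0: "0 < \<rho> z" for z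
    using E0[of z] d[of z] g1[of z] U1[of "snd z"] unfolding \<rho>_def
    by (intro divide_pos_pos mult_pos_pos zero_less_power) auto
  define c where "c z = U (snd z) * g z" for z
  have c1: "1 \<le> c z" for z using mult_mono[OF U1 g1, of "snd z" z] by (simp add: c_def U_def)
  have \<rho>c: "\<rho> z * (c z)\<^sup>2 = E z * min 1 (d z)" for z
    using g1[of z] U1[of "snd z"] by (simp add: \<rho>_def c_def power_mult_distrib)
  have \<rho>b: "\<bar>\<rho> z * f\<bar> \<le> E z * min 1 (d z)" if "\<bar>f\<bar> \<le> (c z)\<^sup>2" for z f
  proof -
    have "\<bar>\<rho> z * f\<bar> \<le> \<rho> z * (c z)\<^sup>2" using that \<rho>0[of z] by (simp add: abs_mult)
    then show ?thesis by (simp add: \<rho>c)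
  qed
  have Em: "E z * min 1 (d z) \<le> E z" for z using E0[of z] by (simp add: mult_left_le)
  have \<rho>uu: "\<bar>\<rho> (x, y) * (u y $ i * u y $ j)\<bar> \<le> E (x, y)" for x y i j
  proof -
    have "\<bar>u y $ i * u y $ j\<bar> \<le> U y * U y"
      using uU[of y] U1[of y] unfolding abs_mult by (intro mult_mono) auto
    also have "\<dots> \<le> (c (x, y))\<^sup>2"
      using g1[of "(x, y)"] U1[of y] unfolding power2_eq_square c_def
      by (intro mult_mono) (auto simp: mult_le_cancel_left1)
    finally show ?thesis using \<rho>b[of _ "(x, y)"] Em[of "(x, y)"] by (meson order_trans)
  qed
  have \<rho>Gu: "\<bar>\<rho> (x, y) * (G (x, y) * u y $ i)\<bar> \<le> E (x, y)" for x y i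
  proof -
    have "\<bar>G (x, y) * u y $ i\<bar> \<le> g (x, y) * U y"
      using uU[of y] U1[of y] unfolding abs_mult by (intro mult_mono) (auto simp: g_def)
    also have "\<dots> \<le> (c (x, y))\<^sup>2"
      using c1[of "(x, y)"] by (simp add: c_def power2_eq_square mult.commute mult_le_cancel_left1)
    finally show ?thesis using \<rho>b[of _ "(x, y)"] Em[of "(x, y)"] by (meson order_trans)
  qed
  have sec[measurable]: "(\<lambda>y. f (x, y)) \<in> borel_measurable borel"
    if [measurable]: "f \<in> borel_measurable borel" for f :: "'a \<times> 'b \<Rightarrow> real" and x
    using measurable_compose[OF borel_measurable_Pair that] by simp
  have iuu: "integrable lborel (\<lambda>y. \<rho> (x, y) * (u y $ i * u y $ j))" for x i j
    by (rule dom'[OF _ \<rho>uu]) measurable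
  have iGu: "integrable lborel (\<lambda>y. \<rho> (x, y) * (G (x, y) * u y $ i))" for x i
    by (rule dom'[OF _ \<rho>Gu]) measurable
  \<comment> \<open>\<open>A x\<close> is the Gram matrix of the components of \<open>u\<close> in
    the space weighted by \<open>\<rho> (x, \<cdot>)\<close>, and \<open>b x\<close> holds their
    inner products with \<open>G (x, \<cdot>)\<close>. The normal equations of the projection are
    \<open>A x *v \<alpha> x = b x\<close>.\<close>
  define A where "A x = (\<chi> i j. \<integral>y. \<rho> (x, y) * (u y $ i * u y $ j) \<partial>lborel)" for x
  define b where "b x = (\<chi> i. \<integral>y. \<rho> (x, y) * (G (x, y) * u y $ i) \<partial>lborel)" for x
  define \<alpha> where "\<alpha> x = (\<chi> k. det (\<chi> i j. if j = k then b x $ i else A x $ i $ j) / det (A x))" for x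
  have A_mult: "(A x *v k) $ i = (\<integral>y. \<rho> (x, y) * (u y $ i * (k \<bullet> u y)) \<partial>lborel)"
    and iAu: "integrable lborel (\<lambda>y. \<rho> (x, y) * (u y $ i * (k \<bullet> u y)))" for x k i
  proof -
    have eq: "\<rho> (x, y) * (u y $ i * (k \<bullet> u y)) = (\<Sum>j\<in>UNIV. \<rho> (x, y) * (u y $ i * u y $ j) * k $ j)" for y
      by (simp add: inner_vec_def sum_distrib_left mult_ac)
    show "integrable lborel (\<lambda>y. \<rho> (x, y) * (u y $ i * (k \<bullet> u y)))"
      unfolding eq by (intro Bochner_Integration.integrable_sum integrable_mult_left iuu)
    show "(A x *v k) $ i = (\<integral>y. \<rho> (x, y) * (u y $ i * (k \<bullet> u y)) \<partial>lborel)"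
      unfolding eq by (subst Bochner_Integration.integral_sum)
        (simp_all add: iuu matrix_vector_mult_def A_def)
  qed
  \<comment> \<open>If \<open>A x *v k = 0\<close>, then pairing with \<open>k\<close> gives a
    vanishing integral of \<open>\<rho> (x, y) * (k \<bullet> u y)\<^sup>2\<close>. Positivity of
    \<rho> and \<open>indep\<close> force \<open>k = 0\<close>.\<close>
  have "det (A x) \<noteq> 0" for x
  proof -
    have "k = 0" if k: "A x *v k = 0" for k
    proof -
      have eq: "\<rho> (x, y) * (k \<bullet> u y)\<^sup>2 = (\<Sum>i\<in>UNIV. k $ i * (\<rho> (x, y) * (u y $ i * (k \<bullet> u y))))" for y
        unfolding power2_eq_square by (subst inner_vec_def) (simp add: sum_distrib_left sum_distrib_right mult_ac)
      have i: "integrable lborel (\<lambda>y. \<rho> (x, y) * (k \<bullet> u y)\<^sup>2)"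
        unfolding eq by (intro Bochner_Integration.integrable_sum integrable_mult_right iAu)
      have "(\<integral>y. \<rho> (x, y) * (k \<bullet> u y)\<^sup>2 \<partial>lborel) = (\<Sum>i\<in>UNIV. k $ i * (A x *v k) $ i)"
        unfolding eq by (subst Bochner_Integration.integral_sum) (simp_all add: iAu A_mult)
      then have "(\<integral>y. \<rho> (x, y) * (k \<bullet> u y)\<^sup>2 \<partial>lborel) = 0" by (simp add: k)
      then have "AE y in lborel. \<rho> (x, y) * (k \<bullet> u y)\<^sup>2 = 0"
        using integral_nonneg_eq_0_iff_AE[OF i] \<rho>0 by (simp add: less_imp_le)
      then have "AE y in lborel. k \<bullet> u y = 0"
        by (rule AE_mp) (use \<rho>0 in \<open>auto simp: less_le\<close>)
      then show "k = 0" by (rule indep)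
    qed
    then show ?thesis
      using matrix_left_invertible_ker[of "A x"] invertible_left_inverse invertible_det_nz by blast
  qed
  then have A\<alpha>: "A x *v \<alpha> x = b x" for x
    by (subst cramer) (simp_all add: \<alpha>_def)
  have [measurable]: "(\<lambda>x. A x $ i $ j) \<in> borel_measurable borel"
      "(\<lambda>x. b x $ i) \<in> borel_measurable borel" for i j
    unfolding A_def b_def by (simp_all, measurable)
  have \<alpha>[measurable]: "\<alpha> \<in> borel_measurable borel"
    unfolding borel_measurable_cart_iff \<alpha>_def det_def by (simp, measurable)
  \<comment> \<open>\<open>R\<close> is the residual of the projection; \<open>R0\<close> restates
    the normal equations as its orthogonality to the components of \<open>u\<close>. The factor
    \<open>a\<close> controls the size of \<alpha>, about which no bound uniform in \<open>x\<close>
    is available.\<close>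
  define R a where "R z = G z - \<alpha> (fst z) \<bullet> u (snd z)" and "a x = 1 + norm (\<alpha> x)" for z x
  have a1: "1 \<le> a x" for x by (simp add: a_def)
  have [measurable]: "R \<in> borel_measurable borel" "a \<in> borel_measurable borel"
    unfolding R_def[abs_def] a_def[abs_def] by measurable
  have R_eq: "\<rho> (x, y) * (R (x, y) * u y $ i)
      = \<rho> (x, y) * (G (x, y) * u y $ i) - \<rho> (x, y) * (u y $ i * (\<alpha> x \<bullet> u y))" for x y i
    by (simp add: R_def algebra_simps)
  have iR: "integrable lborel (\<lambda>y. \<rho> (x, y) * (R (x, y) * u y $ i))" for x i
    unfolding R_eq by (intro Bochner_Integration.integrable_diff iGu iAu)
  have R0: "(\<integral>y. \<rho> (x, y) * (R (x, y) * u y $ i) \<partial>lborel) = 0" for x i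
    unfolding R_eq using A\<alpha>[of x]
    by (subst Bochner_Integration.integral_diff) (simp_all add: iGu iAu A_mult[symmetric], simp add: b_def)
  have gca: "g z \<le> c z * a (fst z)" "U (snd z) \<le> c z * a (fst z)"
      "U (snd z) * a (fst z) \<le> c z * a (fst z)" "1 \<le> c z * a (fst z)" for z
  proof -
    have "g z * 1 \<le> g z * (U (snd z) * a (fst z))" "U (snd z) * 1 \<le> U (snd z) * (g z * a (fst z))"
      "U (snd z) * a (fst z) * 1 \<le> U (snd z) * a (fst z) * g z" "1 * 1 \<le> c z * a (fst z)"
      using g1[of z] U1[of "snd z"] a1[of "fst z"] c1[of z]
      by (intro mult_left_mono mult_mono mult_ge1_I mult_nonneg_nonneg; linarith)+
    then show "g z \<le> c z * a (fst z)" "U (snd z) \<le> c z * a (fst z)"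
      "U (snd z) * a (fst z) \<le> c z * a (fst z)" "1 \<le> c z * a (fst z)"
      by (simp_all add: c_def mult_ac)
  qed
  have \<alpha>u: "\<bar>\<alpha> (fst z) \<bullet> u (snd z)\<bar> \<le> norm (\<alpha> (fst z)) * norm (u (snd z))" for z
    by (rule Cauchy_Schwarz_ineq2)
  have R_le: "\<bar>R z\<bar> \<le> c z * a (fst z)" for z
  proof -
    have "\<bar>R z\<bar> \<le> \<bar>G z\<bar> + norm (\<alpha> (fst z)) * norm (u (snd z))"
      unfolding R_def using \<alpha>u[of z] by linarith
    also have "\<dots> \<le> (1 + \<bar>G z\<bar>) * (1 + norm (\<alpha> (fst z)) * norm (u (snd z)))"
      by (simp add: algebra_simps)
    also have "\<dots> \<le> (1 + \<bar>G z\<bar>) * ((1 + norm (\<alpha> (fst z))) * (1 + norm (u (snd z))))"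
      by (intro mult_left_mono) (auto simp: algebra_simps)
    also have "\<dots> = c z * a (fst z)" by (simp add: c_def g_def U_def a_def mult_ac)
    finally show ?thesis .
  qed
  \<comment> \<open>Dividing by a function of \<open>x\<close> alone preserves the vanishing
    fibrewise moments. By \<open>R_le\<close>, the product of \<eta> with any quantity bounded by
    \<open>c z * a (fst z)\<close> is then dominated by \<open>E\<close>; this covers 1,
    \<open>G\<close>, the components of \<open>u\<close>, and the fitted part.\<close>
  define \<eta> where "\<eta> z = \<rho> z * R z / (a (fst z))\<^sup>2" for z
  have [measurable]: "\<eta> \<in> borel_measurable borel"
    unfolding \<eta>_def[abs_def] by measurable
  have \<eta>b: "\<bar>\<eta> z * f\<bar> \<le> E z * min 1 (d z)" if f: "\<bar>f\<bar> \<le> c z * a (fst z)" for z f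
  proof -
    have "\<bar>\<eta> z * f\<bar> = \<rho> z * (\<bar>R z\<bar> * \<bar>f\<bar>) / (a (fst z))\<^sup>2"
      using \<rho>0[of z] by (simp add: \<eta>_def abs_mult)
    also have "\<dots> \<le> \<rho> z * ((c z * a (fst z)) * (c z * a (fst z))) / (a (fst z))\<^sup>2"
      using R_le[of z] f \<rho>0[of z] by (intro divide_right_mono mult_left_mono mult_mono) auto
    also have "\<dots> = \<rho> z * (c z)\<^sup>2"
      using a1[of "fst z"] by (simp add: power2_eq_square)
    finally show ?thesis by (simp add: \<rho>c)
  qed
  have \<eta>E: "\<bar>\<eta> z * f\<bar> \<le> E z" if f: "\<bar>f\<bar> \<le> c z * a (fst z)" for z f
    using \<eta>b[OF f] Em by (rule order_trans)
  have uc: "\<bar>u y $ i\<bar> \<le> c (x, y) * a x" for x y i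
    using uU[of y i] gca(2)[of "(x, y)"] by simp
  have \<alpha>uc: "\<bar>\<alpha> (fst z) \<bullet> u (snd z)\<bar> \<le> c z * a (fst z)" for z
  proof -
    have "norm (\<alpha> (fst z)) * norm (u (snd z)) \<le> U (snd z) * a (fst z)"
      by (simp add: U_def a_def algebra_simps)
    then show ?thesis using \<alpha>u[of z] gca(3)[of z] by linarith
  qed
  have i\<eta>u: "integrable lborel (\<lambda>y. \<eta> (x, y) * u y $ i)" for x i
  proof (rule dom'[where x = x, OF _ \<eta>E])
    show "\<bar>u y $ i\<bar> \<le> c (x, y) * a (fst (x, y))" for y using uc by simp
  qed measurable
  have \<eta>u0: "(\<integral>y. \<eta> (x, y) * u y $ i \<partial>lborel) = 0" for x i
  proof -
    have "(\<lambda>y. \<eta> (x, y) * u y $ i) = (\<lambda>y. \<rho> (x, y) * (R (x, y) * u y $ i) / (a x)\<^sup>2)"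
      by (simp add: \<eta>_def mult.assoc)
    then show ?thesis using R0[of x i] by simp
  qed
  have i\<eta>\<alpha>: "integrable lborel (\<lambda>z. \<eta> z * (\<alpha> (fst z) \<bullet> u (snd z)))"
    by (rule dom[OF _ \<eta>E[OF \<alpha>uc]]) measurable
  have i\<eta>G: "integrable lborel (\<lambda>z. \<eta> z * G z)"
  proof (intro dom \<eta>E)
    show "\<bar>G z\<bar> \<le> c z * a (fst z)" for z using gca(1)[of z] by (simp add: g_def)
  qed measurable
  show thesis
  proof (rule that[OF _ _ i\<eta>G _ i\<eta>u \<eta>u0])
    show \<eta>d: "\<bar>\<eta> z\<bar> \<le> d z" for z
    proof -
      have "\<bar>\<eta> z\<bar> \<le> E z * min 1 (d z)" using \<eta>b[of 1 z] gca(4) by simp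
      also have "\<dots> \<le> 1 * d z" using E0[of z] E1[of z] d[of z] by (intro mult_mono) auto
      finally show ?thesis by simp
    qed
    show "integrable lborel (\<lambda>z. (\<eta> z)\<^sup>2 / d z)"
    proof (rule dom)
      fix z
      have "\<bar>\<eta> z\<bar> \<le> E z" using \<eta>E[of 1 z] gca(4) by simp
      then have "\<bar>\<eta> z\<bar> * \<bar>\<eta> z\<bar> \<le> E z * d z" using \<eta>d[of z] E0[of z] by (intro mult_mono) auto
      then show "\<bar>(\<eta> z)\<^sup>2 / d z\<bar> \<le> E z"
        using d[of z] by (simp add: power2_eq_square pos_divide_le_eq abs_mult)
    qed measurable
    assume 0: "(\<integral>z. \<eta> z * G z \<partial>lborel) = 0"
    \<comment> \<open>The fitted part has zero pairing with \<eta>, because \<alpha> is constant on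
      fibres. Hence the pairing of \<eta> with \<open>G\<close> equals that with \<open>R\<close>,
      which is the integral of a positive multiple of \<open>R\<^sup>2\<close>.\<close>
    have "(\<integral>y. \<eta> (x, y) * (\<alpha> x \<bullet> u y) \<partial>lborel) = 0" for x
    proof -
      have "(\<lambda>y. \<eta> (x, y) * (\<alpha> x \<bullet> u y)) = (\<lambda>y. \<Sum>i\<in>UNIV. \<alpha> x $ i * (\<eta> (x, y) * u y $ i))"
        by (simp add: inner_vec_def sum_distrib_left mult_ac)
      then show ?thesis by (simp add: Bochner_Integration.integral_sum i\<eta>u \<eta>u0)
    qed
    then have "(\<integral>z. \<eta> z * (\<alpha> (fst z) \<bullet> u (snd z)) \<partial>(lborel \<Otimes>\<^sub>M lborel)) = 0"
      using lborel_pair.integral_fst'[of "\<lambda>z. \<eta> z * (\<alpha> (fst z) \<bullet> u (snd z))"] i\<eta>\<alpha>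
      by (simp add: lborel_prod)
    then have "(\<integral>z. \<eta> z * G z - \<eta> z * (\<alpha> (fst z) \<bullet> u (snd z)) \<partial>lborel) = 0"
      using 0 i\<eta>G i\<eta>\<alpha> by (simp add: lborel_prod)
    moreover have "\<eta> z * G z - \<eta> z * (\<alpha> (fst z) \<bullet> u (snd z)) = \<rho> z * (R z)\<^sup>2 / (a (fst z))\<^sup>2" for z
      by (simp add: \<eta>_def R_def power2_eq_square diff_divide_distrib[symmetric] algebra_simps)
    moreover have "integrable lborel (\<lambda>z. \<eta> z * G z - \<eta> z * (\<alpha> (fst z) \<bullet> u (snd z)))"
      using i\<eta>G i\<eta>\<alpha> by simp
    ultimately have "AE z in lborel. \<rho> z * (R z)\<^sup>2 / (a (fst z))\<^sup>2 = 0"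
      using integral_nonneg_eq_0_iff_AE[of lborel "\<lambda>z. \<rho> z * (R z)\<^sup>2 / (a (fst z))\<^sup>2"] \<rho>0
      by (simp add: less_imp_le)
    then show "AE z in lborel. G z = \<alpha> (fst z) \<bullet> u (snd z)"
    proof (rule AE_mp, intro AE_I2 impI)
      fix z assume "\<rho> z * (R z)\<^sup>2 / (a (fst z))\<^sup>2 = 0"
      then show "G z = \<alpha> (fst z) \<bullet> u (snd z)"
        using \<rho>0[of z] a1[of "fst z"] by (auto simp: R_def)
    qed
  qed measurable
qed

section \<open>The entropy density in Pauli components\<close>

text \<open>Half the trace of \<open>X ln X\<close> for the Hermitian matrix \<open>X\<close> with
  Pauli components \<open>x\<close>, written through its eigenvalues.\<close>

definition pauli_entropy :: "real^4 \<Rightarrow> real" where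
  "pauli_entropy x =
     ((x $ 0 + norm (pauli_vec x)) * ln (x $ 0 + norm (pauli_vec x))
      + (x $ 0 - norm (pauli_vec x)) * ln (x $ 0 - norm (pauli_vec x))) / 2"

text \<open>
  For \<open>pauli_vec x = 0\<close> the quotient by \<open>2 * norm (pauli_vec x)\<close> is \<open>0\<close>, which gives the correct
  (vanishing) spatial gradient.
\<close>

definition pauli_entropy_grad :: "real^4 \<Rightarrow> real^4" where
  "pauli_entropy_grad x = (\<chi> s.
     if s = 0 then 1 + ln ((x $ 0 + norm (pauli_vec x)) * (x $ 0 - norm (pauli_vec x))) / 2
     else ln ((x $ 0 + norm (pauli_vec x)) / (x $ 0 - norm (pauli_vec x))) / (2 * norm (pauli_vec x)) * x $ s)"

text \<open>The coefficients of the part of the density that is linear in \<open>w\<close>.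
  Components 1 and 2 are themselves linear in \<open>p\<close> and will be absorbed into the
  multipliers; only the quadratic term in component 0 stays visible in the final formula.\<close>

definition entropy_drift :: "real \<Rightarrow> real \<Rightarrow> real \<Rightarrow> real^2 \<Rightarrow> real^4" where
  "entropy_drift vF m \<theta> p = (\<chi> s.
     if s = 0 then (norm p)\<^sup>2 / (2 * m * \<theta>)
     else if s = 1 then vF / \<theta> * p $ 1
     else if s = 2 then vF / \<theta> * p $ 2 else 0)"

text \<open>The expansions \<open>sum_4\<close> and \<open>forall_4\<close> end with the index 4;
  this identity turns them into the Pauli numbering from 0 to 3.\<close>

lemma four_eq_zero: "(4 :: 4) = 0"
  by simp

lemma sum_UNIV_4: "sum f (UNIV :: 4 set) = f 0 + f 1 + f 2 + f 3"
  for f :: "4 \<Rightarrow> 'a::ab_group_add"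
  by (simp add: sum_4 four_eq_zero)

lemma forall_UNIV_4: "(\<forall>s :: 4. P s) \<longleftrightarrow> P 0 \<and> P 1 \<and> P 2 \<and> P 3"
  using forall_4[of P] by (auto simp: four_eq_zero)

lemma pauli_vec_add: "pauli_vec (x + y) = pauli_vec x + pauli_vec y"
  by (simp add: pauli_vec_def vec_eq_iff forall_3)

lemma inner_pauli_vec: "pauli_vec x \<bullet> pauli_vec y = x $ 1 * y $ 1 + x $ 2 * y $ 2 + x $ 3 * y $ 3"
  by (simp add: pauli_vec_def inner_vec_def sum_3)

lemma norm_pauli_vec: "norm (pauli_vec x) = sqrt ((x $ 1)\<^sup>2 + (x $ 2)\<^sup>2 + (x $ 3)\<^sup>2)"
  by (simp add: norm_eq_sqrt_inner inner_pauli_vec power2_eq_square)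

lemma norm_sq_pauli: "(norm x)\<^sup>2 = (x $ 0)\<^sup>2 + (norm (pauli_vec x))\<^sup>2" for x :: "real^4"
  unfolding power2_norm_eq_inner inner_pauli_vec by (simp add: inner_vec_def sum_UNIV_4 power2_eq_square)

text \<open>This is the shape of the linear term subtracted in
  \<open>spectral_entropy_bregman_bounds\<close>.\<close>

lemma pauli_entropy_grad_inner:
  "pauli_entropy_grad x \<bullet> h = h $ 0 * (1 + ln ((x $ 0 + norm (pauli_vec x)) * (x $ 0 - norm (pauli_vec x))) / 2)
    + ln ((x $ 0 + norm (pauli_vec x)) / (x $ 0 - norm (pauli_vec x))) / (2 * norm (pauli_vec x)) * (pauli_vec x \<bullet> pauli_vec h)"
proof -
  define a K where "a = 1 + ln ((x $ 0 + norm (pauli_vec x)) * (x $ 0 - norm (pauli_vec x))) / 2"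
    and "K = ln ((x $ 0 + norm (pauli_vec x)) / (x $ 0 - norm (pauli_vec x))) / (2 * norm (pauli_vec x))"
  have "pauli_entropy_grad x = (\<chi> s. if s = 0 then a else K * x $ s)"
    by (simp only: pauli_entropy_grad_def a_def K_def)
  then have "pauli_entropy_grad x \<bullet> h = h $ 0 * a + K * (pauli_vec x \<bullet> pauli_vec h)"
    unfolding inner_pauli_vec by (simp add: inner_vec_def sum_UNIV_4 algebra_simps)
  then show ?thesis by (simp only: a_def K_def)
qed

lemma pauli_entropy_bregman_bounds:
  assumes "norm (pauli_vec x) < x $ 0" "norm (pauli_vec (x + h)) < (x + h) $ 0"
  shows "0 \<le> pauli_entropy (x + h) - pauli_entropy x - pauli_entropy_grad x \<bullet> h"
    and "pauli_entropy (x + h) - pauli_entropy x - pauli_entropy_grad x \<bullet> h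
           \<le> 3 / 2 * (norm h)\<^sup>2 / (x $ 0 - norm (pauli_vec x))"
  using spectral_entropy_bregman_bounds[of "pauli_vec x" "x $ 0" "pauli_vec h" "h $ 0"] assms
  by (simp_all add: pauli_entropy_grad_inner pauli_entropy_def norm_sq_pauli pauli_vec_add)

text \<open>Changing a single component by \<open>c\<close>, be it the scalar or a vector one,
  lowers \<open>x $ 0 - norm (pauli_vec x)\<close> by at most \<open>\<bar>c\<bar>\<close>.\<close>

lemma pauli_cone_add_axis:
  assumes "norm (pauli_vec x) < x $ 0" "\<bar>c\<bar> < x $ 0 - norm (pauli_vec x)"
  shows "norm (pauli_vec (x + axis s c)) < (x + axis s c) $ 0"
proof -
  have "\<forall>s. norm (pauli_vec (axis s c)) - axis s c $ 0 \<le> \<bar>c\<bar>"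
    unfolding forall_UNIV_4 by (simp add: norm_pauli_vec axis_def)
  then have "norm (pauli_vec (axis s c)) - axis s c $ 0 \<le> \<bar>c\<bar>" ..
  moreover have "norm (pauli_vec (x + axis s c)) \<le> norm (pauli_vec x) + norm (pauli_vec (axis s c))"
    unfolding pauli_vec_add by (rule norm_triangle_ineq)
  ultimately show ?thesis using assms by simp
qed

text \<open>The eigenvalues of \<open>x\<close> are the exponentials of \<open>y $ 0 - 1 + Q\<close>
  and \<open>y $ 0 - 1 - Q\<close>. Their half-sum is \<open>x $ 0\<close>, which yields the
  \<open>cosh\<close>; their half-difference is the length of the vector part, which yields the
  \<open>sinh\<close>.\<close>

lemma pauli_entropy_grad_inverse:
  fixes x :: "real^4"
  assumes x: "norm (pauli_vec x) < x $ 0"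
  defines "y \<equiv> pauli_entropy_grad x"
  defines "Q \<equiv> sqrt ((y $ 1)\<^sup>2 + (y $ 2)\<^sup>2 + (y $ 3)\<^sup>2)"
  shows "x $ 0 = cosh Q * exp (y $ 0 - 1)"
    and "s \<noteq> 0 \<Longrightarrow> x $ s = y $ s * sinhc Q * exp (y $ 0 - 1)"
proof -
  define n a b where "n = norm (pauli_vec x)" and "a = x $ 0 + n" and "b = x $ 0 - n"
  have b: "0 < b" and n0: "0 \<le> n" using x by (auto simp: b_def n_def)
  have a: "0 < a" and ba: "b \<le> a" using b n0 by (auto simp: a_def b_def)
  define L where "L = ln (a / b) / (2 * n)"
  have L0: "0 \<le> L" using a b ba n0 by (simp add: L_def)
  have y: "s \<noteq> 0 \<Longrightarrow> y $ s = L * x $ s" for s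
    by (simp add: y_def pauli_entropy_grad_def L_def n_def a_def b_def)
  have "(L * x $ 1)\<^sup>2 + (L * x $ 2)\<^sup>2 + (L * x $ 3)\<^sup>2 = L\<^sup>2 * ((x $ 1)\<^sup>2 + (x $ 2)\<^sup>2 + (x $ 3)\<^sup>2)"
    by (simp add: power_mult_distrib algebra_simps)
  then have "Q = L * n"
    using L0 by (simp add: Q_def y real_sqrt_mult n_def norm_pauli_vec)
  \<comment> \<open>For \<open>n = 0\<close> the eigenvalues coincide and both sides are 0.\<close>
  then have Q: "Q = (ln a - ln b) / 2"
    using a b by (cases "n = 0") (auto simp: L_def ln_div a_def b_def)
  have y0: "y $ 0 - 1 = (ln a + ln b) / 2"
    using a b by (simp add: y_def pauli_entropy_grad_def n_def a_def b_def ln_mult)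
  have e: "exp Q * exp (y $ 0 - 1) = a" "exp (- Q) * exp (y $ 0 - 1) = b"
  proof -
    have "Q + (y $ 0 - 1) = ln a" "- Q + (y $ 0 - 1) = ln b"
      unfolding Q y0 by argo+
    then show "exp Q * exp (y $ 0 - 1) = a" "exp (- Q) * exp (y $ 0 - 1) = b"
      using a b by (simp_all add: exp_add[symmetric] del: add_uminus_conv_diff)
  qed
  have "cosh Q * exp (y $ 0 - 1) = (exp Q * exp (y $ 0 - 1) + exp (- Q) * exp (y $ 0 - 1)) / 2"
    by (simp add: cosh_field_def algebra_simps)
  then show "x $ 0 = cosh Q * exp (y $ 0 - 1)"
    by (simp only: e) (simp add: a_def b_def)
  assume s: "s \<noteq> 0"
  show "x $ s = y $ s * sinhc Q * exp (y $ 0 - 1)"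
  \<comment> \<open>If \<open>n = 0\<close>, both \<open>x $ s\<close> and \<open>y $ s\<close>
    vanish. Otherwise \<open>y $ s / Q = x $ s / n\<close>, and the remaining factor
    \<open>sinh Q * exp (y $ 0 - 1)\<close> is \<open>n\<close>.\<close>
  proof (cases "n = 0")
    case True
    then have "(x $ 1)\<^sup>2 + (x $ 2)\<^sup>2 + (x $ 3)\<^sup>2 = 0" by (simp add: n_def norm_pauli_vec)
    then have "x $ 1 = 0 \<and> x $ 2 = 0 \<and> x $ 3 = 0" by (simp add: add_nonneg_eq_0_iff)
    then have "x $ s = 0" using s forall_UNIV_4[of "\<lambda>s. s \<noteq> 0 \<longrightarrow> x $ s = 0"] by simp
    then show ?thesis using y[OF s] by simp
  next
    case False
    then have "b < a" using n0 by (simp add: a_def b_def)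
    then have Q0: "Q \<noteq> 0" using a b by (simp add: Q)
    have "sinh Q * exp (y $ 0 - 1) = (exp Q * exp (y $ 0 - 1) - exp (- Q) * exp (y $ 0 - 1)) / 2"
      by (simp add: sinh_field_def algebra_simps)
    then have "sinh Q * exp (y $ 0 - 1) = n" by (simp only: e) (simp add: a_def b_def)
    moreover have "y $ s * sinhc Q * exp (y $ 0 - 1) = L * x $ s / Q * (sinh Q * exp (y $ 0 - 1))"
      using Q0 by (simp add: y[OF s] sinhc_def)
    ultimately show ?thesis using Q0 \<open>Q = L * n\<close> by simp
  qed
qed

text \<open>With \<open>n / x\<close> as argument, the logarithms in \<open>entropy_c\<close> become
  logarithms of the eigenvalues \<open>x + n\<close> and \<open>x - n\<close>, and the leftover
  \<open>- ln x\<close> cancels the explicit \<open>ln (w (r, p) $ 0)\<close>.\<close>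

lemma entropy_integrand_eq:
  assumes "norm (pauli_vec (w (r, p))) < w (r, p) $ 0"
  shows "entropy_integrand vF m \<theta> w (r, p) = pauli_entropy (w (r, p)) + entropy_drift vF m \<theta> p \<bullet> w (r, p)"
proof -
  define x n where "x = w (r, p) $ 0" and "n = norm (pauli_vec (w (r, p)))"
  have n: "0 \<le> n" "n < x" using assms by (auto simp: x_def n_def)
  then have "1 - (n / x)\<^sup>2 = (x + n) * (x - n) / x\<^sup>2"
    by (simp add: field_simps power2_eq_square)
  moreover have "(1 + n / x) / (1 - n / x) = (x + n) / (x - n)"
    using n by (simp add: field_simps)
  ultimately have "entropy_c (n / x) = (ln (x + n) + ln (x - n) - 2 * ln x) / 2
      + n / x / 2 * (ln (x + n) - ln (x - n))"
    using n by (simp add: entropy_c_def ln_div ln_mult ln_realpow)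
  then have "x * (ln x + entropy_c (n / x)) = ((x + n) * ln (x + n) + (x - n) * ln (x - n)) / 2"
    using n by (simp add: field_simps)
  then show ?thesis
    by (simp add: entropy_integrand_def pauli_entropy_def entropy_drift_def inner_vec_def sum_UNIV_4
      distrib_left distrib_right x_def n_def mult_ac)
qed

text \<open>This is the independence hypothesis of \<open>ex_orthogonal_test_function\<close> for
  the functions 1, \<open>p $ 1\<close>, \<open>p $ 2\<close>. A nonzero affine function vanishes at
  most on a line.\<close>

lemma affine_AE_zero_imp_zero:
  fixes c :: "real^3"
  assumes "AE p :: real^2 in lborel. c \<bullet> vector [1, p $ 1, p $ 2] = 0"
  shows "c = 0"
proof -
  have f: "c \<bullet> vector [1, p $ 1, p $ 2] = c $ 1 + vector [c $ 2, c $ 3] \<bullet> p" for p :: "real^2"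
    by (simp add: inner_vec_def sum_3 sum_2)
  have "AE p :: real^2 in lebesgue. vector [c $ 2, c $ 3] \<bullet> p = - c $ 1"
    using assms unfolding f AE_completion_iff by (rule AE_mp) simp
  then have "{p :: real^2. vector [c $ 2, c $ 3] \<bullet> p \<noteq> - c $ 1} \<in> null_sets lebesgue"
    by (subst (asm) AE_iff_null) (auto simp: completion.complete2)
  then have neg: "negligible {p :: real^2. vector [c $ 2, c $ 3] \<bullet> p \<noteq> - c $ 1}"
    by (simp add: negligible_iff_null_sets)
  \<comment> \<open>The zero set is negligible if the normal vector is nonzero, and empty if only
    the constant is. Together with its negligible complement it would make the whole plane
    negligible.\<close>
  have eq: "vector [c $ 2, c $ 3] = (0 :: real^2) \<and> c $ 1 = 0"
  proof (rule ccontr)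
    assume "\<not> ?thesis"
    then have "negligible {p :: real^2. vector [c $ 2, c $ 3] \<bullet> p = - c $ 1}"
      by (intro negligible_hyperplane) auto
    from negligible_Un[OF this neg]
    show False by (simp add: set_eq_iff Un_def)
  qed
  then show ?thesis by (simp add: vec_eq_iff forall_3 forall_2)
qed

text \<open>Sections and Fubini are used for Borel functions on \<open>lborel\<close>, while
  admissible functions are only Lebesgue measurable. A Borel representative, chosen componentwise,
  bridges the two.\<close>

lemma lebesgue_ex_borel_cart:
  fixes f :: "'a::euclidean_space \<Rightarrow> real^'n"
  assumes "f \<in> borel_measurable lebesgue"
  obtains g where "g \<in> borel_measurable borel" "AE x in lborel. f x = g x"
proof -
  have "\<exists>g. g \<in> borel_measurable lborel \<and> (AE x in lborel. f x $ i = g x)" for i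
    using completion_ex_borel_measurable_real[of "\<lambda>x. f x $ i" lborel] assms
    by (auto simp: borel_measurable_cart_iff[of f])
  then obtain g where g: "\<And>i. g i \<in> borel_measurable lborel" "\<And>i. AE x in lborel. f x $ i = g i x"
    by metis
  show thesis
  proof
    show "(\<lambda>x. \<chi> i. g i x) \<in> borel_measurable borel"
      unfolding borel_measurable_cart_iff using g(1) by simp
    have "AE x in lborel. \<forall>i. f x $ i = g i x"
      using g(2) by (simp add: eventually_all_finite)
    then show "AE x in lborel. f x = (\<chi> i. g i x)"
      by (rule AE_mp) (simp add: vec_eq_iff)
  qed
qed

lemma borel_measurable_pauli [measurable]:
  assumes "f \<in> borel_measurable M"
  shows "(\<lambda>x. f x $ s) \<in> borel_measurable M"
    and "(\<lambda>x. norm (pauli_vec (f x))) \<in> borel_measurable M"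
    and "(\<lambda>x. pauli_entropy_grad (f x) $ s) \<in> borel_measurable M"
proof -
  have c[measurable]: "(\<lambda>x. f x $ s) \<in> borel_measurable M" for s
    using assms by (simp add: borel_measurable_cart_iff)
  then show "(\<lambda>x. f x $ s) \<in> borel_measurable M" .
  have n[measurable]: "(\<lambda>x. norm (pauli_vec (f x))) \<in> borel_measurable M"
    unfolding norm_pauli_vec by measurable
  then show "(\<lambda>x. norm (pauli_vec (f x))) \<in> borel_measurable M" .
  show "(\<lambda>x. pauli_entropy_grad (f x) $ s) \<in> borel_measurable M"
  proof (cases "s = 0")
    case True
    then show ?thesis unfolding pauli_entropy_grad_def by (simp, measurable)
  next
    case False
    then show ?thesis unfolding pauli_entropy_grad_def by (simp, measurable)
  qed
qed

lemma borel_measurable_entropy_integrand: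
  fixes w :: wigner
  assumes w: "w \<in> borel_measurable lebesgue"
  shows "entropy_integrand vF m \<theta> w \<in> borel_measurable lebesgue"
proof -
  have "(snd :: (real^2) \<times> (real^2) \<Rightarrow> real^2) \<in> borel_measurable borel"
    by (intro borel_measurable_continuous_onI continuous_intros)
  then have snd: "(snd :: (real^2) \<times> (real^2) \<Rightarrow> real^2) \<in> borel_measurable lebesgue"
    by (simp add: measurable_completion)
  have eq: "entropy_integrand vF m \<theta> w = (\<lambda>z.
     w z $ 0 * (ln (w z $ 0) + entropy_c (norm (pauli_vec (w z)) / w z $ 0) + (norm (snd z))\<^sup>2 / (2 * m * \<theta>))
     + vF / \<theta> * (snd z $ 1 * w z $ 1 + snd z $ 2 * w z $ 2))"
    by (simp add: entropy_integrand_def fun_eq_iff)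
  define c n p where "c s z = w z $ s" and "n z = norm (pauli_vec (w z))" and "p k z = snd z $ k"
    for s :: 4 and k :: 2 and z :: "(real^2) \<times> (real^2)"
  have [measurable]: "c s \<in> borel_measurable lebesgue" "n \<in> borel_measurable lebesgue"
      "p k \<in> borel_measurable lebesgue" for s k
    using borel_measurable_pauli[OF w] snd
    by (simp_all add: c_def[abs_def] n_def[abs_def] p_def[abs_def] borel_measurable_cart_iff[of snd])
  have [measurable]: "(\<lambda>z :: (real^2) \<times> (real^2). norm (snd z)) \<in> borel_measurable lebesgue"
    by (rule measurable_compose[OF snd borel_measurable_norm])
  show ?thesis
    unfolding eq entropy_c_def c_def[symmetric] n_def[symmetric] p_def[symmetric] by measurable
qed

section \<open>Euler--Lagrange equation\<close>

lemma quadratic_nonneg_imp_linear_zero: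
  fixes a b :: real
  assumes "\<And>t. \<bar>t\<bar> < 1 \<Longrightarrow> 0 \<le> t * a + t\<^sup>2 * b"
  shows "a = 0"
proof (rule ccontr)
  assume a: "a \<noteq> 0"
  \<comment> \<open>The sign of \<open>t\<close> is opposite to that of \<open>a\<close>, and
    \<open>K\<close> is large enough to give both \<open>\<bar>t\<bar> < 1\<close> and
    \<open>K > b\<close>, so that the quadratic expression is negative.\<close>
  define K t where "K = 2 * (\<bar>a\<bar> + \<bar>b\<bar>)" and "t = - a / K"
  have K: "K > 0" using a by (simp add: K_def)
  have "\<bar>t\<bar> < 1" using a K by (simp add: t_def K_def)
  then have "0 \<le> t * a + t\<^sup>2 * b" by (rule assms)
  also have "\<dots> = a\<^sup>2 / K\<^sup>2 * (b - K)"
    using K by (simp add: t_def field_simps power2_eq_square)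
  finally have "K \<le> b" using a K by (simp add: zero_le_mult_iff zero_le_divide_iff)
  then show False using a by (simp add: K_def)
qed

text \<open>The entropy changes by \<open>t\<close> times the integral in the conclusion plus at
  most a constant times \<open>t\<^sup>2\<close>. As \<open>t\<close> may have either sign,
  minimality kills the linear coefficient. The Borel version \<open>v\<close> lies in the cone
  everywhere, so the estimates hold wherever \<open>w\<close> agrees with it.\<close>

lemma entropy_first_variation:
  fixes w v :: wigner and \<eta> :: "(real^2) \<times> (real^2) \<Rightarrow> real"
  assumes min: "is_arg_min (entropy vF m \<theta>) (\<lambda>w. admissible vF m \<theta> w \<and> has_moments n J w) w"
    and v[measurable]: "v \<in> borel_measurable borel"
    and cone: "\<And>z. norm (pauli_vec (v z)) < v z $ 0"
    and wv: "AE z in lborel. w z = v z"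
    and \<eta>[measurable]: "\<eta> \<in> borel_measurable borel"
    and \<eta>_le: "\<And>z. \<bar>\<eta> z\<bar> \<le> v z $ 0 - norm (pauli_vec (v z))"
    and \<eta>_sq: "integrable lborel (\<lambda>z. (\<eta> z)\<^sup>2 / (v z $ 0 - norm (pauli_vec (v z))))"
    and \<eta>_grad: "integrable lborel
        (\<lambda>z. \<eta> z * (pauli_entropy_grad (v z) + entropy_drift vF m \<theta> (snd z)) $ s)"
    and m0: "\<And>r. integrable lborel (\<lambda>p. \<eta> (r, p))" "\<And>r. (\<integral>p. \<eta> (r, p) \<partial>lborel) = 0"
    and m1: "\<And>r k. integrable lborel (\<lambda>p. \<eta> (r, p) * p $ k)"
      "\<And>r k. (\<integral>p. \<eta> (r, p) * p $ k \<partial>lborel) = 0"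
  shows "(\<integral>z. \<eta> z * (pauli_entropy_grad (v z) + entropy_drift vF m \<theta> (snd z)) $ s \<partial>lborel) = 0"
proof (rule quadratic_nonneg_imp_linear_zero)
  define d where "d z = v z $ 0 - norm (pauli_vec (v z))" for z
  define G where "G z = (pauli_entropy_grad (v z) + entropy_drift vF m \<theta> (snd z)) $ s" for z
  have d0: "0 < d z" for z using cone by (simp add: d_def)
  have adm: "admissible vF m \<theta> w" and mom: "has_moments n J w"
    and le: "\<And>w'. admissible vF m \<theta> w' \<Longrightarrow> has_moments n J w' \<Longrightarrow> entropy vF m \<theta> w \<le> entropy vF m \<theta> w'"
    using min unfolding is_arg_min_def by (auto simp: not_less)
  have [measurable]: "w \<in> borel_measurable lebesgue"
    and mom_w: "AE r in lebesgue. \<forall>s. integrable lebesgue (\<lambda>p. w (r, p) $ s) \<and>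
                            (\<forall>k. integrable lebesgue (\<lambda>p. p $ k * w (r, p) $ s))"
    and int_w: "integrable lebesgue (entropy_integrand vF m \<theta> w)"
    using adm by (auto simp: admissible_def)
  have \<eta>L[measurable]: "\<eta> \<in> borel_measurable lebesgue" using \<eta> by (simp add: measurable_completion)
  have sec[measurable]: "(\<lambda>p. \<eta> (r, p)) \<in> borel_measurable borel" for r
    using measurable_compose[OF borel_measurable_Pair \<eta>] by simp
  have iG: "integrable lebesgue (\<lambda>z. \<eta> z * G z)"
    using \<eta>_grad borel_measurable_integrable[OF \<eta>_grad]
    by (simp add: G_def integrable_completion)
  have iq: "integrable lebesgue (\<lambda>z. (\<eta> z)\<^sup>2 / d z)"
    using \<eta>_sq borel_measurable_integrable[OF \<eta>_sq]
    by (simp add: d_def integrable_completion)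
  have m0': "integrable lebesgue (\<lambda>p. \<eta> (r, p))" "(\<integral>p. \<eta> (r, p) \<partial>lebesgue) = 0" for r
    using m0[of r] by (simp_all add: integrable_completion integral_completion)
  have m1': "integrable lebesgue (\<lambda>p. \<eta> (r, p) * p $ k)" "(\<integral>p. \<eta> (r, p) * p $ k \<partial>lebesgue) = 0" for r k
    using m1[of r k] borel_measurable_integrable[OF m1(1)[of r k]]
    by (simp_all add: integrable_completion integral_completion)
  fix t :: real assume t: "\<bar>t\<bar> < 1"
  \<comment> \<open>The perturbation is added to \<open>w\<close> itself rather than to
    \<open>v\<close>: the moments of \<open>w\<close> are known fibre by fibre, and those of \<eta>
    vanish on every fibre, so the constraints carry over directly.\<close>
  define w' where "w' z = w z + axis s (t * \<eta> z)" for z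
  have ax: "axis s (t * x) $ i = (if i = s then t else 0) * x" for x i
    by (simp add: axis_def)
  have w'[measurable]: "w' \<in> borel_measurable lebesgue"
    unfolding borel_measurable_cart_iff w'_def[abs_def] vector_add_component ax by measurable
  have cone': "norm (pauli_vec (v z + axis s (t * \<eta> z))) < (v z + axis s (t * \<eta> z)) $ 0" for z
  proof (rule pauli_cone_add_axis[OF cone])
    have "\<bar>t * \<eta> z\<bar> \<le> \<bar>t\<bar> * d z"
      using \<eta>_le[of z] unfolding abs_mult by (intro mult_left_mono) (auto simp: d_def)
    also have "\<dots> < 1 * d z" using t d0[of z] by (intro mult_strict_right_mono)
    finally show "\<bar>t * \<eta> z\<bar> < v z $ 0 - norm (pauli_vec (v z))" by (simp add: d_def)
  qed
  have wv': "AE z in lebesgue. w z = v z" using wv by (simp add: AE_completion_iff)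
  have cone_w': "AE x in lebesgue. norm (pauli_vec (w' x)) < w' x $ 0"
    using wv' by (rule AE_mp) (use cone' in \<open>simp add: w'_def\<close>)
  \<comment> \<open>The tangent bounds enclose the remainder between 0 and the quadratic term. The
    two-sided form serves twice: for the integrability of the perturbed density and for the estimate
    of its integral.\<close>
  have diff: "AE z in lebesgue. \<bar>entropy_integrand vF m \<theta> w' z - entropy_integrand vF m \<theta> w z - t * (\<eta> z * G z)\<bar>
      \<le> 3 / 2 * t\<^sup>2 * ((\<eta> z)\<^sup>2 / d z)"
    using wv'
  proof (rule AE_mp, intro AE_I2 impI)
    fix z assume wz: "w z = v z"
    obtain r p where z: "z = (r, p)" by (cases z)
    define h where "h = axis s (t * \<eta> z)"
    have w'z: "w' z = v z + h" using wz by (simp add: w'_def h_def)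
    have e: "entropy_integrand vF m \<theta> w z = pauli_entropy (v z) + entropy_drift vF m \<theta> p \<bullet> v z"
      "entropy_integrand vF m \<theta> w' z = pauli_entropy (v z + h) + entropy_drift vF m \<theta> p \<bullet> (v z + h)"
      using entropy_integrand_eq[of w r p] entropy_integrand_eq[of w' r p] cone[of z] cone'[of z] wz w'z
      by (simp_all add: z h_def)
    have "pauli_entropy_grad (v z) \<bullet> h + entropy_drift vF m \<theta> p \<bullet> h = t * (\<eta> z * G z)"
      by (simp add: h_def inner_axis G_def z algebra_simps)
    moreover have "(norm h)\<^sup>2 = t\<^sup>2 * (\<eta> z)\<^sup>2"
      unfolding power2_norm_eq_inner by (simp add: h_def inner_axis_axis power2_eq_square mult_ac)
    ultimately show "\<bar>entropy_integrand vF m \<theta> w' z - entropy_integrand vF m \<theta> w z - t * (\<eta> z * G z)\<bar>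
        \<le> 3 / 2 * t\<^sup>2 * ((\<eta> z)\<^sup>2 / d z)"
      using pauli_entropy_bregman_bounds[OF cone[of z] cone'[of z], folded h_def]
      by (simp add: e inner_add_right d_def)
  qed
  have [measurable]: "entropy_integrand vF m \<theta> w' \<in> borel_measurable lebesgue"
    by (rule borel_measurable_entropy_integrand) measurable
  define B where "B z = entropy_integrand vF m \<theta> w' z - entropy_integrand vF m \<theta> w z - t * (\<eta> z * G z)" for z
  have iC: "integrable lebesgue (\<lambda>z. 3 / 2 * t\<^sup>2 * ((\<eta> z)\<^sup>2 / d z))"
    using iq by (rule integrable_mult_right)
  have iB: "integrable lebesgue B"
  proof (rule Bochner_Integration.integrable_bound[OF iC])
    show "B \<in> borel_measurable lebesgue"
      using borel_measurable_integrable[OF int_w] borel_measurable_integrable[OF iG]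
      unfolding B_def[abs_def] by simp
    show "AE z in lebesgue. norm (B z) \<le> norm (3 / 2 * t\<^sup>2 * ((\<eta> z)\<^sup>2 / d z))"
      using diff by (rule AE_mp) (use d0 in \<open>auto simp: B_def less_imp_le\<close>)
  qed
  have F': "entropy_integrand vF m \<theta> w' = (\<lambda>z. entropy_integrand vF m \<theta> w z + t * (\<eta> z * G z) + B z)"
    by (simp add: B_def)
  have int_w': "integrable lebesgue (entropy_integrand vF m \<theta> w')"
    unfolding F' using int_w iG iB by simp
  have comp: "w' (r, p) $ i = w (r, p) $ i + (if i = s then t else 0) * \<eta> (r, p)" for r p i
    by (simp add: w'_def ax)
  have comp': "p $ k * w' (r, p) $ i = p $ k * w (r, p) $ i + (if i = s then t else 0) * (\<eta> (r, p) * p $ k)"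
    for r p i k by (simp add: comp algebra_simps)
  have "admissible vF m \<theta> w'"
    unfolding admissible_def
  proof (intro conjI w' cone_w' int_w')
    show "AE r in lebesgue. \<forall>i. integrable lebesgue (\<lambda>p. w' (r, p) $ i) \<and>
                            (\<forall>k. integrable lebesgue (\<lambda>p. p $ k * w' (r, p) $ i))"
      using mom_w
    proof (rule AE_mp, intro AE_I2 impI allI conjI)
      fix r i k assume "\<forall>s. integrable lebesgue (\<lambda>p. w (r, p) $ s) \<and>
                            (\<forall>k. integrable lebesgue (\<lambda>p. p $ k * w (r, p) $ s))"
      then show "integrable lebesgue (\<lambda>p. w' (r, p) $ i)"
        and "integrable lebesgue (\<lambda>p. p $ k * w' (r, p) $ i)"
        unfolding comp' unfolding comp
        by (intro Bochner_Integration.integrable_add integrable_mult_right m0' m1'; simp)+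
    qed
  qed
  moreover have "has_moments n J w'"
    unfolding has_moments_def
    using AE_conjI[OF mom_w mom[unfolded has_moments_def]]
  proof (rule AE_mp, intro AE_I2 impI allI conjI)
    fix r i k assume *: "(\<forall>s. integrable lebesgue (\<lambda>p. w (r, p) $ s) \<and>
          (\<forall>k. integrable lebesgue (\<lambda>p. p $ k * w (r, p) $ s))) \<and>
        (\<forall>s. integral\<^sup>L lebesgue (\<lambda>p. w (r, p) $ s) = n s r \<and>
          (\<forall>k. integral\<^sup>L lebesgue (\<lambda>p. p $ k * w (r, p) $ s) = J s k r))"
    show "integral\<^sup>L lebesgue (\<lambda>p. w' (r, p) $ i) = n i r"
      unfolding comp using * m0'[of r]
      by (subst Bochner_Integration.integral_add) auto
    show "integral\<^sup>L lebesgue (\<lambda>p. p $ k * w' (r, p) $ i) = J i k r"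
      unfolding comp' using * m1'[of r k]
      by (subst Bochner_Integration.integral_add) auto
  qed
  ultimately have "entropy vF m \<theta> w \<le> entropy vF m \<theta> w'" by (rule le)
  also have "\<dots> = entropy vF m \<theta> w + t * (\<integral>z. \<eta> z * G z \<partial>lebesgue) + (\<integral>z. B z \<partial>lebesgue)"
    unfolding entropy_def F' using int_w iG iB by simp
  also have "(\<integral>z. B z \<partial>lebesgue) \<le> (\<integral>z. 3 / 2 * t\<^sup>2 * ((\<eta> z)\<^sup>2 / d z) \<partial>lebesgue)"
  proof (rule integral_mono_AE[OF iB iC])
    show "AE z in lebesgue. B z \<le> 3 / 2 * t\<^sup>2 * ((\<eta> z)\<^sup>2 / d z)"
      using diff by (rule AE_mp) (intro AE_I2 impI, unfold B_def, linarith)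
  qed
  also have "\<dots> = t\<^sup>2 * (3 / 2 * (\<integral>z. (\<eta> z)\<^sup>2 / d z \<partial>lebesgue))"
    by (simp only: integral_mult_right_zero)
  also have "(\<integral>z. \<eta> z * G z \<partial>lebesgue) = (\<integral>z. \<eta> z * G z \<partial>lborel)"
    using borel_measurable_integrable[OF \<eta>_grad] by (simp add: integral_completion G_def)
  finally show "0 \<le> t * (\<integral>z. \<eta> z * (pauli_entropy_grad (v z) + entropy_drift vF m \<theta> (snd z)) $ s \<partial>lborel)
      + t\<^sup>2 * (3 / 2 * (\<integral>z. (\<eta> z)\<^sup>2 / d z \<partial>lebesgue))"
    by (simp add: G_def)
qed

text \<open>The test function is built for \<open>u = (1, p $ 1, p $ 2)\<close>, whose moments are
  those fixed by the constraints, and for the distance to the cone boundary as \<open>d\<close>. The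
  components of \<alpha> are the Lagrange multipliers of the constraints on component
  \<open>s\<close>.\<close>

lemma minimizer_grad_affine:
  fixes w v :: wigner
  assumes min: "is_arg_min (entropy vF m \<theta>) (\<lambda>w. admissible vF m \<theta> w \<and> has_moments n J w) w"
    and v[measurable]: "v \<in> borel_measurable borel"
    and cone: "\<And>z. norm (pauli_vec (v z)) < v z $ 0"
    and wv: "AE z in lborel. w z = v z"
  obtains \<alpha> :: "real^2 \<Rightarrow> real^3" where
    "AE z in lborel. (pauli_entropy_grad (v z) + entropy_drift vF m \<theta> (snd z)) $ s
       = \<alpha> (fst z) \<bullet> vector [1, snd z $ 1, snd z $ 2]"
proof -
  define u :: "real^2 \<Rightarrow> real^3" where "u p = vector [1, p $ 1, p $ 2]" for p
  have snd[measurable]: "(snd :: (real^2) \<times> (real^2) \<Rightarrow> real^2) \<in> borel_measurable borel"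
    by (intro borel_measurable_continuous_onI continuous_intros)
  have [measurable]: "(\<lambda>p :: real^2. p $ k) \<in> borel_measurable borel" for k
    by (intro borel_measurable_continuous_onI continuous_intros)
  have u[measurable]: "u \<in> borel_measurable borel"
    unfolding borel_measurable_cart_iff forall_3 u_def by simp
  have d[measurable]: "(\<lambda>z. v z $ 0 - norm (pauli_vec (v z))) \<in> borel_measurable borel"
    by measurable
  have [measurable]: "(\<lambda>z :: (real^2) \<times> (real^2). entropy_drift vF m \<theta> (snd z) $ s) \<in> borel_measurable borel"
    unfolding entropy_drift_def by simp
  have G: "(\<lambda>z. (pauli_entropy_grad (v z) + entropy_drift vF m \<theta> (snd z)) $ s) \<in> borel_measurable borel"
    by simp
  obtain \<alpha> \<eta> where \<eta>: "\<eta> \<in> borel_measurable borel"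
    "\<And>z. \<bar>\<eta> z\<bar> \<le> v z $ 0 - norm (pauli_vec (v z))"
    "integrable lborel (\<lambda>z. \<eta> z * (pauli_entropy_grad (v z) + entropy_drift vF m \<theta> (snd z)) $ s)"
    "integrable lborel (\<lambda>z. (\<eta> z)\<^sup>2 / (v z $ 0 - norm (pauli_vec (v z))))"
    and m: "\<And>x i. integrable lborel (\<lambda>y. \<eta> (x, y) * u y $ i)"
    "\<And>x i. (\<integral>y. \<eta> (x, y) * u y $ i \<partial>lborel) = 0"
    and *: "(\<integral>z. \<eta> z * (pauli_entropy_grad (v z) + entropy_drift vF m \<theta> (snd z)) $ s \<partial>lborel) = 0 \<Longrightarrow>
      AE z in lborel. (pauli_entropy_grad (v z) + entropy_drift vF m \<theta> (snd z)) $ s = \<alpha> (fst z) \<bullet> u (snd z)"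
    by (rule ex_orthogonal_test_function[OF G d u])
      (use cone affine_AE_zero_imp_zero in \<open>auto simp: u_def\<close>)
  have m1: "integrable lborel (\<lambda>p. \<eta> (r, p) * p $ k)" "(\<integral>p. \<eta> (r, p) * p $ k \<partial>lborel) = 0" for r k
    using m[of r 2] m[of r 3] exhaust_2[of k] by (auto simp: u_def)
  show thesis
    by (rule that[OF *[unfolded u_def]], rule entropy_first_variation[OF min v cone wv \<eta>(1,2,4,3) _ _ m1])
      (use m[of _ 1] in \<open>simp_all add: u_def\<close>)
qed

section \<open>Hyperbolic form of the minimizer\<close>

theorem theorem6:
  fixes vF m \<theta> :: real
    and n :: "4 \<Rightarrow> real^2 \<Rightarrow> real"
    and J :: "4 \<Rightarrow> 2 \<Rightarrow> real^2 \<Rightarrow> real"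
    and w :: wigner
  assumes "vF > 0" "m > 0" "\<theta> > 0"
    and "is_arg_min (entropy vF m \<theta>) (\<lambda>w. admissible vF m \<theta> w \<and> has_moments n J w) w"
  shows "\<exists>(a :: 4 \<Rightarrow> real^2 \<Rightarrow> real) (b :: 4 \<Rightarrow> 2 \<Rightarrow> real^2 \<Rightarrow> real).
    let q0 = (\<lambda>r p :: real^2. 1 + a 0 r + b 0 1 r * p $ 1 + b 0 2 r * p $ 2
                               + (norm p)\<^sup>2 / (2 * m * \<theta>));
        q = (\<lambda>(s :: 4) r (p :: real^2). a s r + b s 1 r * p $ 1 + b s 2 r * p $ 2);
        Q = (\<lambda>r p. sqrt ((q 1 r p)\<^sup>2 + (q 2 r p)\<^sup>2 + (q 3 r p)\<^sup>2))
    in AE (r, p) in lebesgue.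
         w (r, p) $ 0 = cosh (Q r p) * exp (- q0 r p) \<and>
         (\<forall>s\<in>{1, 2, 3}. w (r, p) $ s = q s r p * sinhc (Q r p) * exp (- q0 r p))"
proof -
  have min: "is_arg_min (entropy vF m \<theta>) (\<lambda>w. admissible vF m \<theta> w \<and> has_moments n J w) w" by fact
  then have adm: "admissible vF m \<theta> w" by (simp add: is_arg_min_def)
  obtain v' where v'[measurable]: "v' \<in> borel_measurable borel" and wv': "AE z in lborel. w z = v' z"
    using lebesgue_ex_borel_cart[of w] adm by (auto simp: admissible_def)
  \<comment> \<open>The value \<open>axis 0 1\<close> on the exceptional null set is a point of the
    cone, so the cone condition holds everywhere.\<close>
  define v where "v z = (if norm (pauli_vec (v' z)) < v' z $ 0 then v' z else axis 0 1)" for z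
  have v: "v \<in> borel_measurable borel" unfolding v_def by measurable
  have cone: "norm (pauli_vec (v z)) < v z $ 0" for z
    by (auto simp: v_def norm_pauli_vec axis_def)
  have "AE z in lborel. norm (pauli_vec (w z)) < w z $ 0"
    using adm by (simp add: admissible_def AE_completion_iff)
  then have wv: "AE z in lborel. w z = v z"
    using wv' by eventually_elim (auto simp: v_def)
  have "\<forall>s. \<exists>\<alpha> :: real^2 \<Rightarrow> real^3. AE z in lborel.
      (pauli_entropy_grad (v z) + entropy_drift vF m \<theta> (snd z)) $ s
        = \<alpha> (fst z) \<bullet> vector [1, snd z $ 1, snd z $ 2]"
    by (rule allI, rule minimizer_grad_affine[OF min v cone wv], rule exI)
  then obtain \<alpha> :: "4 \<Rightarrow> real^2 \<Rightarrow> real^3" where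
    "\<And>s. AE z in lborel. (pauli_entropy_grad (v z) + entropy_drift vF m \<theta> (snd z)) $ s
        = \<alpha> s (fst z) \<bullet> vector [1, snd z $ 1, snd z $ 2]"
    unfolding choice_iff by blast
  then have "AE z in lborel. \<forall>s. (pauli_entropy_grad (v z) + entropy_drift vF m \<theta> (snd z)) $ s
        = \<alpha> s (fst z) \<bullet> vector [1, snd z $ 1, snd z $ 2]"
    by (simp add: eventually_all_finite)
  with wv have ae: "AE z in lborel. \<forall>s. pauli_entropy_grad (w z) $ s
      = \<alpha> s (fst z) $ 1 + \<alpha> s (fst z) $ 2 * snd z $ 1 + \<alpha> s (fst z) $ 3 * snd z $ 2
        - entropy_drift vF m \<theta> (snd z) $ s \<and> norm (pauli_vec (w z)) < w z $ 0"
    by eventually_elim (use cone in \<open>auto simp: inner_vec_def sum_3 algebra_simps\<close>)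
  \<comment> \<open>Component 0 changes sign because the formulas contain \<open>exp (- q0)\<close>.
    In \<alpha> the first entry belongs to the constant function, hence the entries 2 and 3 for
    \<open>k = 1\<close> and \<open>k = 2\<close>. The drift terms
    \<open>vF / \<theta> * p $ s\<close> for \<open>s = 1, 2\<close> are moved into
    \<open>b\<close>.\<close>
  define a where "a s r = (if s = 0 then - \<alpha> s r $ 1 else \<alpha> s r $ 1)" for s r
  define b where "b s k r = (let c = \<alpha> s r $ (if k = 1 then 2 else 3) in
      if s = 0 then - c else if s = 1 \<and> k = 1 \<or> s = 2 \<and> k = 2 then c - vF / \<theta> else c)"
    for s :: 4 and k :: 2 and r
  define q0 where "q0 = (\<lambda>r p :: real^2. 1 + a 0 r + b 0 1 r * p $ 1 + b 0 2 r * p $ 2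
                               + (norm p)\<^sup>2 / (2 * m * \<theta>))"
  define q where "q = (\<lambda>(s :: 4) r (p :: real^2). a s r + b s 1 r * p $ 1 + b s 2 r * p $ 2)"
  define Q where "Q = (\<lambda>r p. sqrt ((q 1 r p)\<^sup>2 + (q 2 r p)\<^sup>2 + (q 3 r p)\<^sup>2))"
  have "AE z in lborel. w z $ 0 = cosh (Q (fst z) (snd z)) * exp (- q0 (fst z) (snd z)) \<and>
      (\<forall>s\<in>{1, 2, 3}. w z $ s = q s (fst z) (snd z) * sinhc (Q (fst z) (snd z)) * exp (- q0 (fst z) (snd z)))"
    using ae
  proof eventually_elim
    case (elim z)
    then have cone_z: "norm (pauli_vec (w z)) < w z $ 0"
      and grad: "\<And>s. pauli_entropy_grad (w z) $ s
      = \<alpha> s (fst z) $ 1 + \<alpha> s (fst z) $ 2 * snd z $ 1 + \<alpha> s (fst z) $ 3 * snd z $ 2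
        - entropy_drift vF m \<theta> (snd z) $ s" by blast+
    \<comment> \<open>The constant 1 in \<open>q0\<close> matches the shift in
      \<open>pauli_entropy_grad_inverse\<close>, which comes from the derivative
      \<open>ln x + 1\<close> of \<open>x ln x\<close>.\<close>
    have g0: "- q0 (fst z) (snd z) = pauli_entropy_grad (w z) $ 0 - 1"
      unfolding grad[of 0] by (simp add: q0_def a_def b_def entropy_drift_def Let_def)
    have g: "\<forall>s. s \<noteq> 0 \<longrightarrow> q s (fst z) (snd z) = pauli_entropy_grad (w z) $ s"
      unfolding forall_UNIV_4 grad[of 1] grad[of 2] grad[of 3]
      by (simp add: q_def a_def b_def entropy_drift_def Let_def algebra_simps)
    have Q: "Q (fst z) (snd z) = sqrt ((pauli_entropy_grad (w z) $ 1)\<^sup>2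
        + (pauli_entropy_grad (w z) $ 2)\<^sup>2 + (pauli_entropy_grad (w z) $ 3)\<^sup>2)"
      using g by (simp add: Q_def)
    show ?case
      unfolding g0 Q
    proof (intro conjI ballI pauli_entropy_grad_inverse(1)[OF cone_z])
      fix s :: 4 assume "s \<in> {1, 2, 3}"
      then have "s \<noteq> 0" by auto
      with g show "w z $ s = q s (fst z) (snd z) * sinhc (sqrt ((pauli_entropy_grad (w z) $ 1)\<^sup>2
          + (pauli_entropy_grad (w z) $ 2)\<^sup>2 + (pauli_entropy_grad (w z) $ 3)\<^sup>2))
          * exp (pauli_entropy_grad (w z) $ 0 - 1)"
        using pauli_entropy_grad_inverse(2)[OF cone_z] by simp
    qed
  qed
  then have "AE (r, p) in lebesgue. w (r, p) $ 0 = cosh (Q r p) * exp (- q0 r p) \<and>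
      (\<forall>s\<in>{1, 2, 3}. w (r, p) $ s = q s r p * sinhc (Q r p) * exp (- q0 r p))"
    by (simp add: AE_completion_iff case_prod_beta)
  then show ?thesis
    unfolding Let_def Q_def q_def q0_def by - (rule exI[of _ a], rule exI[of _ b], assumption)
qed

end
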